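(* Let $\{X^k\}$ be generated by the EIRNRI algorithm described in the context. Let $C_1>0$ be a constant with $\max_{i\in[m]}\sigma_i\big(\frac{X^k+Y^k}{2}-\frac1{2\beta}\nabla f(Y^k)\big)\le C_1$ for all $k\in\mathbb{N}$ (such a constant exists), and let $\mathcal I^*$ be the index set with $\mathcal I(X^k)=\mathcal I^*$ for all sufficiently large $k$ (such a set exists). Then $\mathrm{Rank}(X^k)=r^*:=|\mathcal I^*|$ for all sufficiently large $k$. Moreover, for any limit point $X^*$ of $\{X^k\}$, $\mathrm{Rank}(X^* )=|\mathcal I(X^* )|=r^*$ and $$\sigma_i(X^* )\ge\Big(\frac{\lambda p}{2\beta C_1}\Big)^{\frac1{1-p}}>0,\qquad i\in\mathcal I(X^* ).$$
   Context: Problem and assumptions. $m\le n$, $p\in(0,1)$, $\lambda>0$; $\sigma_1(X)\ge\dots\ge\sigma_m(X)\ge0$ are the singular values of $X\in\mathbb{R}^{m\times n}$; $F(X)=f(X)+\lambda\sum_{i=1}^m\sigma_i(X)^p$, where $f:\mathbb{R}^{m\times n}\to\mathbb{R}$ is twice continuously differentiable and $\|\nabla f(X)-\nabla f(Y)\|_F\le L_f\|X-Y\|_F$ for all $X,Y$ ($L_f\ge0$). $F$ is level-bounded, i.e. $F(X)\to+\infty$ as $\|X\|\to\infty$ (so $F$ is bounded below and has a minimizer). $[m]=\{1,\dots,m\}$; $\mathcal I(X)=\{i\in[m]:\sigma_i(X)>0\}$, $\mathcal Z(X)=\{i\in[m]:\sigma_i(X)=0\}$. EIRNRI algorithm. Fix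 $\beta>L_f$, $\mu\in(0,1)$, $X^{-1}=X^0\in\mathbb{R}^{m\times n}$, $\bm\epsilon^0\in\mathbb{R}^m$ with positive, non-increasing entries, and $\bar\alpha$ with $\bar\alpha\in(0,1)$ if $f$ is convex, and $\bar\alpha\in\big(0,\sqrt{\beta/(\beta+3L_f)}\big)$ otherwise. For $k=0,1,2,\dots$: choose $\alpha_k\in[0,\bar\alpha]$; set $w_i^k=p(\sigma_i(X^k)+\epsilon_i^k)^{p-1}$, $i\in[m]$; set $Y^k=X^k+\alpha_k(X^k-X^{k-1})$; let $U^{k+1}\mathrm{diag}(\Sigma^{k+1})(V^{k+1})^\top$ be a singular value decomposition (singular values in non-increasing order) of $\frac{X^k+Y^k}{2}-\frac{\nabla f(Y^k)}{2\beta}$ and set $X^{k+1}=U^{k+1}\mathrm{diag}\big(\big[\Sigma_i^{k+1}-\frac{\lambda w_i^k}{2\beta}\big]_+\big)(V^{k+1})^\top$, which is a global minimizer of $X\mapsto f(Y^k)+\langle X,\nabla f(Y^k)\rangle+\frac\beta2\|X-Y^k\|_F^2+\frac\beta2\|X-X^k\|_F^2+\lambda\sum_{i}w_i^k\sigma_i(X)$; then update $\bm\epsilon^k$ to $\bm\epsilon^{k+1}$ as follows. Update of $\bm\epsilon$. Write $r=|\mathcal I(X^k)|$, $r^+=|\mathcal I(X^{k+1})|$. Case $\mathcal I(X^{k+1})\subsetneq\mathcal I(X^k)$: $\epsilon_i^{k+1}=\mu\epsilon_i^k$ for $i\in\mathcal I(X^{k+1})$; put $\tau_1=\sigma_{r^+}(X^{k+1})+\epsilon_{r^+}^{k+1}$,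 $\tau_2=\epsilon_{r^++1}^k$; for $i\in\mathcal I(X^k)\setminus\mathcal I(X^{k+1})$ set $\epsilon_i^{k+1}=\epsilon_i^k$ if $\tau_1\ge\tau_2$, and $\epsilon_i^{k+1}=\min(\epsilon_i^k,\mu\tau_1)$ otherwise; put $\tau_3=\epsilon_r^{k+1}$ and set $\epsilon_i^{k+1}=\min\{\epsilon_i^k,\tau_3\}$ for $i\in\mathcal Z(X^k)$. Case $\mathcal I(X^k)\subsetneq\mathcal I(X^{k+1})$: $\epsilon_i^{k+1}=\mu\epsilon_i^k$ for $i\in\mathcal I(X^k)$; put $\tau_3=\epsilon_r^k$ and set $\epsilon_i^{k+1}=\mu\min\{\epsilon_i^k,\tau_3\}$ for $i\in\mathcal I(X^{k+1})\setminus\mathcal I(X^k)$; put $\tau_1=\sigma_{r^+}(X^{k+1})+\epsilon_{r^+}^{k+1}$, $\tau_2=\epsilon^k_{r^++1}$; for $i\in\mathcal Z(X^{k+1})$ set $\epsilon_i^{k+1}=\epsilon_i^k$ if $\tau_1\ge\tau_2$, and $\min(\epsilon_i^k,\mu\tau_1)$ otherwise. Case $\mathcal I(X^k)=\mathcal I(X^{k+1})$: $\epsilon_i^{k+1}=\mu\epsilon_i^k$ for $i\in\mathcal I(X^{k+1})$; put $\tau_1=\sigma_{r^+}(X^{k+1})+\epsilon_{r^+}^{k+1}$, $\tau_2=\epsilon^k_{r^++1}$; for $i\in\mathcal Z(X^{k+1})$ set $\epsilon_i^{k+1}=\epsilon_i^k$ if $\tau_1\ge\tau_2$, and $\min(\epsilon_i^k,\mu\tau_1)$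 otherwise. Convention: a threshold $\tau_1$ or $\tau_3$ whose defining index is $0$ is $+\infty$. *)

theory Defs
  imports "HOL-Analysis.Analysis"
begin

text \<open>
  Throughout, an $m \times n$ matrix is a value of type \<open>real^'n^'m\<close>, so that the norm and the
  inner product of this type are the Frobenius norm and the Frobenius inner product. Vectors
  indexed by $[m] = \{1,\dots,m\}$, whose order matters (singular values, perturbations), are
  functions on \<open>nat\<close> of which only the values on \<open>{1..CARD('m)}\<close> are relevant.
\<close>

text \<open>
  The diagonal entry at row \<open>i :: 'm\<close> is \<open>s j\<close>, where \<open>j\<close> is the position of \<open>i\<close> in a fixed
  enumeration of \<open>'m\<close> by \<open>1, \<dots>, CARD('m)\<close> (\<open>to_nat_on\<close> counts from \<open>0\<close>). The choice of
  the enumeration is immaterial: in a singular value decomposition it only permutes the columns of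
  both factors simultaneously.
\<close>
definition diag_mat :: "(nat \<Rightarrow> real) \<Rightarrow> real^'m^'m" where
  "diag_mat s = (\<chi> i j. if i = j then s (Suc (to_nat_on (UNIV :: 'm set) i)) else 0)"

text \<open>
  Singular value decomposition $A = U\,\mathrm{diag}(s)\,V^\top$ for $m \le n$, with $U$
  orthogonal of size $m \times m$ and $V$ of size $n \times m$ with orthonormal columns.
\<close>
definition is_svd :: "real^'n^'m \<Rightarrow> real^'m^'m \<Rightarrow> (nat \<Rightarrow> real) \<Rightarrow> real^'m^'n \<Rightarrow> bool" where
  "is_svd A U s V \<longleftrightarrow>
     orthogonal_matrix U \<and> transpose V ** V = mat 1 \<and>
     antimono_on {1..CARD('m)} s \<and> (\<forall>i\<in>{1..CARD('m)}. 0 \<le> s i) \<and>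
     A = U ** diag_mat s ** transpose V"

text \<open>
  \<open>sing_val A i\<close> is the \<open>i\<close>-th largest singular value. For $m \le n$ a singular value decomposition
  exists and its diagonal is unique on $[m]$; the values outside $[m]$ are fixed to be \<open>0\<close>.
\<close>
definition sing_val :: "real^'n^'m \<Rightarrow> nat \<Rightarrow> real" where
  "sing_val A = (THE s. (\<exists>U V. is_svd A U s V) \<and> (\<forall>i. i \<notin> {1..CARD('m)} \<longrightarrow> s i = 0))"

definition pos_idx :: "real^'n^'m \<Rightarrow> nat set" where
  "pos_idx A = {i \<in> {1..CARD('m)}. sing_val A i > 0}"

definition zero_idx :: "real^'n^'m \<Rightarrow> nat set" where
  "zero_idx A = {i \<in> {1..CARD('m)}. sing_val A i = 0}"

definition objective ::
  "(real^'n^'m \<Rightarrow> real) \<Rightarrow> real \<Rightarrow> real \<Rightarrow> real^'n^'m \<Rightarrow> real" where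
  "objective f lam p A = f A + lam * (\<Sum>i=1..CARD('m). sing_val A i powr p)"

text \<open>\<open>f\<close> is twice continuously differentiable and its gradient is \<open>g\<close>.\<close>
definition C2_with_gradient :: "('a::real_inner \<Rightarrow> real) \<Rightarrow> ('a \<Rightarrow> 'a) \<Rightarrow> bool" where
  "C2_with_gradient f g \<longleftrightarrow>
     (\<forall>x. GDERIV f x :> g x) \<and>
     (\<exists>H :: 'a \<Rightarrow> 'a \<Rightarrow>\<^sub>L 'a.
        (\<forall>x. (g has_derivative blinfun_apply (H x)) (at x)) \<and> continuous_on UNIV H)"

text \<open>
  One update from \<open>e\<close> $= \epsilon^k$ to \<open>e'\<close> $= \epsilon^{k+1}$, where \<open>A\<close> $= X^k$ and
  \<open>A'\<close> $= X^{k+1}$. The thresholds are extended reals, as they are \<open>\<infinity>\<close> when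
  their defining index is \<open>0\<close>. The index sets of positive singular values are initial segments of
  $[m]$, so the three cases are exhaustive. If \<open>r' = m\<close> then \<open>e (r' + 1)\<close> is
  meaningless, but then no index uses \<open>\<tau>2\<close>.
\<close>
definition eps_update ::
  "real \<Rightarrow> real^'n^'m \<Rightarrow> real^'n^'m \<Rightarrow> (nat \<Rightarrow> real) \<Rightarrow> (nat \<Rightarrow> real) \<Rightarrow> bool" where
  "eps_update \<mu> A A' e e' \<longleftrightarrow>
    (let r = card (pos_idx A);
         r' = card (pos_idx A');
         \<tau>1 = (if r' = 0 then \<infinity> else ereal (sing_val A' r' + e' r'));
         \<tau>2 = ereal (e (r' + 1));
         capped = (\<lambda>i. ereal (e' i) =
            (if \<tau>1 \<ge> \<tau>2 then ereal (e i) else min (ereal (e i)) (ereal \<mu> * \<tau>1)))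
     in
      (pos_idx A' \<subset> pos_idx A \<longrightarrow>
        (let \<tau>3 = (if r = 0 then \<infinity> else ereal (e' r)) in
          (\<forall>i\<in>pos_idx A'. e' i = \<mu> * e i) \<and>
          (\<forall>i\<in>pos_idx A - pos_idx A'. capped i) \<and>
          (\<forall>i\<in>zero_idx A. ereal (e' i) = min (ereal (e i)) \<tau>3))) \<and>
      (pos_idx A \<subset> pos_idx A' \<longrightarrow>
        (let \<tau>3 = (if r = 0 then \<infinity> else ereal (e r)) in
          (\<forall>i\<in>pos_idx A. e' i = \<mu> * e i) \<and>
          (\<forall>i\<in>pos_idx A' - pos_idx A. ereal (e' i) = ereal \<mu> * min (ereal (e i)) \<tau>3) \<and>
          (\<forall>i\<in>zero_idx A'. capped i))) \<and>
      (pos_idx A = pos_idx A' \<longrightarrow>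
          (\<forall>i\<in>pos_idx A'. e' i = \<mu> * e i) \<and>
          (\<forall>i\<in>zero_idx A'. capped i)))"

text \<open>$X^{k-1}$, with the convention $X^{-1} = X^0$.\<close>
definition prev_iterate :: "(nat \<Rightarrow> 'a) \<Rightarrow> nat \<Rightarrow> 'a" where
  "prev_iterate X k = (if k = 0 then X 0 else X (k - 1))"

text \<open>The extrapolated point $Y^k$.\<close>
definition extrapolate :: "(nat \<Rightarrow> real) \<Rightarrow> (nat \<Rightarrow> 'a::real_vector) \<Rightarrow> nat \<Rightarrow> 'a" where
  "extrapolate \<alpha> X k = X k + \<alpha> k *\<^sub>R (X k - prev_iterate X k)"

text \<open>The matrix $\frac{X^k + Y^k}{2} - \frac{1}{2\beta}\nabla f(Y^k)$, with \<open>g\<close> $= \nabla f$.\<close>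
definition grad_point ::
  "('a::real_vector \<Rightarrow> 'a) \<Rightarrow> real \<Rightarrow> (nat \<Rightarrow> real) \<Rightarrow> (nat \<Rightarrow> 'a) \<Rightarrow> nat \<Rightarrow> 'a" where
  "grad_point g \<beta> \<alpha> X k =
     (1/2) *\<^sub>R (X k + extrapolate \<alpha> X k) - (1 / (2 * \<beta>)) *\<^sub>R g (extrapolate \<alpha> X k)"

definition weight :: "real \<Rightarrow> real^'n^'m \<Rightarrow> (nat \<Rightarrow> real) \<Rightarrow> nat \<Rightarrow> real" where
  "weight p A e i = p * (sing_val A i + e i) powr (p - 1)"

text \<open>
  The sequence \<open>X\<close>, with perturbations \<open>\<epsilon> k i\<close> $= \epsilon_i^k$ and extrapolation parameters
  \<open>\<alpha> k\<close> $\in [0,\bar\alpha]$, is generated by the algorithm for the gradient map \<open>g\<close>. Neither the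
  singular value decomposition chosen in each step nor the choice of \<open>\<alpha> k\<close> is prescribed.
\<close>
definition EIRNRI ::
  "(real^'n^'m \<Rightarrow> real^'n^'m) \<Rightarrow> real \<Rightarrow> real \<Rightarrow> real \<Rightarrow> real \<Rightarrow> real \<Rightarrow>
   (nat \<Rightarrow> real) \<Rightarrow> (nat \<Rightarrow> nat \<Rightarrow> real) \<Rightarrow> (nat \<Rightarrow> real^'n^'m) \<Rightarrow> bool" where
  "EIRNRI g lam p \<beta> \<mu> \<alpha>bar \<alpha> \<epsilon> X \<longleftrightarrow>
     (\<forall>i\<in>{1..CARD('m)}. 0 < \<epsilon> 0 i) \<and> antimono_on {1..CARD('m)} (\<epsilon> 0) \<and>
     (\<forall>k. \<alpha> k \<in> {0..\<alpha>bar} \<and>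
        (\<exists>U \<Sigma> V. is_svd (grad_point g \<beta> \<alpha> X k) U \<Sigma> V \<and>
           X (Suc k) =
             U ** diag_mat (\<lambda>i. max 0 (\<Sigma> i - lam * weight p (X k) (\<epsilon> k) i / (2 * \<beta>)))
               ** transpose V) \<and>
        eps_update \<mu> (X k) (X (Suc k)) (\<epsilon> k) (\<epsilon> (Suc k)))"

definition seq_limit_point :: "(nat \<Rightarrow> 'a::topological_space) \<Rightarrow> 'a \<Rightarrow> bool" where
  "seq_limit_point X x \<longleftrightarrow> (\<exists>s. strict_mono s \<and> (X \<circ> s) \<longlonglongrightarrow> x)"

end

theory Submission
  imports Defs
begin

text \<open>
  The theorem rests on a gap for the singular values. If the \<open>i\<close>-th singular value of \<open>X (Suc k)\<close> is
  positive, it has survived the soft thresholding, so that its threshold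
  \<open>lam * weight p (X k) (\<epsilon> k) i / (2 * \<beta>)\<close> is less than \<open>C1\<close>. The weight is the decreasing
  function \<open>x \<mapsto> p * x powr (p - 1)\<close> of \<open>x = sing_val (X k) i + \<epsilon> k i\<close>, and hence \<open>x\<close> is at least
  \<open>b = (lam * p / (2 * \<beta> * C1)) powr (1 / (1 - p))\<close> (\<open>EIRNRI_pos_idx_lower_bound\<close>). Once the support
  is constantly \<open>Istar\<close>, the update multiplies \<open>\<epsilon> k i\<close> by \<open>\<mu> < 1\<close> for all \<open>i\<close> in \<open>Istar\<close>
  (\<open>EIRNRI_eps_tendsto_0\<close>). In a limit point \<open>Xstar\<close>, the singular values with index in \<open>Istar\<close> are
  therefore at least \<open>b > 0\<close> and the others are \<open>0\<close>; its support is \<open>Istar\<close>, and the rank of a matrix is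
  the size of its support (\<open>rank_eq_card_pos_idx\<close>).

  Two points need work. The first is that the diagonal produced by the thresholding lists the singular
  values of the next iterate in their order. For this the weights must be non-decreasing in \<open>i\<close>,
  that is, \<open>\<sigma> + \<epsilon>\<close> must be non-increasing along the whole iteration; \<open>\<epsilon>\<close> itself is not.
  The invariant \<open>admissible_eps\<close> is preserved by the update (\<open>eps_update_admissible\<close>) and
  implies this.

  The second is the linear algebra of singular values. Their existence (\<open>svd_exists\<close>) follows from
  maximising a weighted trace over pairs of matrices with orthonormal rows, their uniqueness
  (\<open>svd_values_unique\<close>) from counting the values above a threshold, and their convergence along
  a subsequence (\<open>sing_val_subseq_tendsto\<close>) from the compactness of the set of orthonormal
  factors.
\<close>

section \<open>Diagonal matrices\<close>

definition diag_index :: "'m::finite \<Rightarrow> nat" where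
  "diag_index i = Suc (to_nat_on (UNIV :: 'm set) i)"

lemma bij_diag_index: "bij_betw (diag_index :: 'm::finite \<Rightarrow> nat) UNIV {1..CARD('m)}"
proof -
  have "bij_betw (to_nat_on (UNIV :: 'm set)) UNIV {..<CARD('m)}"
    by (rule to_nat_on_finite) simp
  moreover have "bij_betw Suc {..<CARD('m)} {1..CARD('m)}"
    by (simp add: bij_betw_def lessThan_atLeast0 image_Suc_atLeastLessThan atLeastLessThanSuc_atLeastAtMost)
  ultimately have "bij_betw (Suc \<circ> to_nat_on (UNIV :: 'm set)) UNIV {1..CARD('m)}"
    by (rule bij_betw_trans)
  then show ?thesis by (simp add: diag_index_def[abs_def] comp_def)
qed

lemma diag_index_in_range [simp]: "diag_index (i :: 'm::finite) \<in> {1..CARD('m)}"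
  using bij_diag_index by (auto simp: bij_betw_def)

lemma inj_diag_index: "inj (diag_index :: 'm::finite \<Rightarrow> nat)"
  using bij_diag_index by (auto simp: bij_betw_def)

lemma diag_index_cases:
  assumes "n \<in> {1..CARD('m)}"
  obtains i :: "'m::finite" where "n = diag_index i"
proof -
  have "n \<in> range (diag_index :: 'm \<Rightarrow> nat)"
    using bij_diag_index[where 'm='m] assms by (simp add: bij_betw_def)
  then show thesis using that by blast
qed

lemma diag_mat_entry: "diag_mat s $ i $ j = (if i = j then s (diag_index i) else 0)"
  by (simp add: diag_mat_def diag_index_def)

lemma matrix_mult_diag_mat: "(A ** diag_mat s) $ i $ j = A $ i $ j * s (diag_index j)"
  by (simp add: matrix_matrix_mult_def diag_mat_entry if_distrib cong: if_cong)

lemma diag_mat_matrix_mult: "(diag_mat s ** A) $ i $ j = s (diag_index i) * A $ i $ j"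
  by (simp add: matrix_matrix_mult_def diag_mat_entry if_distrib[of "\<lambda>x. x * _"] cong: if_cong)

lemma diag_mat_vector_mult: "(diag_mat s *v x) $ i = s (diag_index i) * x $ i"
  by (simp add: matrix_vector_mult_def diag_mat_entry if_distrib[of "\<lambda>x. x * _"] cong: if_cong)

lemma diag_mat_cong:
  assumes "\<And>n. n \<in> {1..CARD('m)} \<Longrightarrow> s n = t n"
  shows "(diag_mat s :: real^'m^'m) = diag_mat t"
  unfolding vec_eq_iff diag_mat_entry using assms[OF diag_index_in_range] by simp

lemma transpose_diag_mat: "transpose (diag_mat s) = diag_mat s"
  by (simp add: vec_eq_iff transpose_def diag_mat_entry)

section \<open>Existence of the singular value decomposition\<close>

definition orthonormal_rows :: "(real^'n^'m) set" where
  "orthonormal_rows = {Q. \<forall>i j. Q $ i \<bullet> Q $ j = (if i = j then 1 else 0)}"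

lemma matrix_mult_transpose_entry: "(A ** transpose B) $ i $ j = A $ i \<bullet> B $ j" for A B :: "real^'n^'m"
  by (simp add: matrix_matrix_mult_def transpose_def inner_vec_def)

lemma orthonormal_rows_iff: "Q \<in> orthonormal_rows \<longleftrightarrow> Q ** transpose Q = mat 1"
  by (auto simp: orthonormal_rows_def vec_eq_iff matrix_mult_transpose_entry mat_def)

lemma compact_orthonormal_rows: "compact (orthonormal_rows :: (real^'n^'m) set)"
proof -
  have "closed {Q :: real^'n^'m. Q $ i \<bullet> Q $ j = (if i = j then 1 else 0)}" for i j
    by (intro closed_Collect_eq continuous_intros)
  then have "closed (orthonormal_rows :: (real^'n^'m) set)"
    unfolding orthonormal_rows_def by (intro closed_Collect_all)
  moreover have "norm Q \<le> real CARD('m)" if "Q \<in> orthonormal_rows" for Q :: "real^'n^'m"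
  proof -
    have "norm Q \<le> (\<Sum>i\<in>UNIV. norm (Q $ i))"
      by (simp add: norm_vec_def L2_set_le_sum)
    also have "\<dots> = real CARD('m)"
      using that by (simp add: orthonormal_rows_def norm_eq_sqrt_inner)
    finally show ?thesis .
  qed
  ultimately show ?thesis
    by (auto simp: compact_eq_bounded_closed bounded_iff)
qed

lemma orthonormal_rows_nonempty:
  assumes "CARD('m) \<le> CARD('n)"
  shows "(orthonormal_rows :: (real^'n^'m) set) \<noteq> {}"
proof -
  obtain h :: "'m \<Rightarrow> 'n" where "inj h"
    using card_le_inj[of "UNIV :: 'm set" "UNIV :: 'n set"] assms by auto
  then have "(\<chi> i. axis (h i) 1) \<in> (orthonormal_rows :: (real^'n^'m) set)"
    by (auto simp: orthonormal_rows_def inner_axis_axis inj_eq)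
  then show ?thesis by blast
qed

text \<open>
  The first-order condition of the maximum at angle \<open>0\<close>, in the form in which rotations are used
  below: the left-hand side is a sinusoid of amplitude \<open>sqrt (a\<^sup>2 + b\<^sup>2)\<close>, which can only stay below
  \<open>a\<close> if \<open>b\<close> vanishes.
\<close>
lemma cos_sin_max_zero:
  fixes a b :: real
  assumes "\<And>t. a * cos t + b * sin t \<le> a"
  shows "b = 0"
proof (rule ccontr)
  assume "b \<noteq> 0"
  define R where "R = sqrt (a\<^sup>2 + b\<^sup>2)"
  have R: "R > 0" "R\<^sup>2 = a\<^sup>2 + b\<^sup>2"
    using \<open>b \<noteq> 0\<close> by (auto simp: R_def add_nonneg_pos)
  then have "(a / R)\<^sup>2 + (b / R)\<^sup>2 = 1"
    using \<open>b \<noteq> 0\<close> by (simp add: power_divide flip: add_divide_distrib)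
  then obtain t where t: "a / R = cos t" "b / R = sin t"
    by (rule sincos_total_2pi)
  have "a * cos t + b * sin t = (a\<^sup>2 + b\<^sup>2) / R"
    by (simp add: power2_eq_square add_divide_distrib flip: t)
  also have "\<dots> = R"
    unfolding R(2)[symmetric] using R(1) by (simp add: power2_eq_square)
  finally have "R \<le> a" using assms[of t] by simp
  then have "R\<^sup>2 \<le> a\<^sup>2" using R(1) by (intro power_mono) auto
  then show False using R(2) \<open>b \<noteq> 0\<close> by simp
qed

text \<open>
  Optimality conditions for maximising a linear functional over the compact set of matrices with
  orthonormal rows. Each condition comes from a competitor that stays in this set: rotating two rows
  within the plane that they span gives the symmetry, changing the sign of one row gives the
  nonnegativity, and rotating one row towards a vector orthogonal to all rows gives the last
  condition.
\<close>
lemma orthonormal_rows_linear_max: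
  fixes c :: "'m::finite \<Rightarrow> real^'n" and Q :: "real^'n^'m"
  assumes Q: "Q \<in> orthonormal_rows"
    and max: "\<And>R. R \<in> orthonormal_rows \<Longrightarrow> (\<Sum>k\<in>UNIV. c k \<bullet> R $ k) \<le> (\<Sum>k\<in>UNIV. c k \<bullet> Q $ k)"
  shows "c i \<bullet> Q $ j = c j \<bullet> Q $ i"
    and "c i \<bullet> Q $ i \<ge> 0"
    and "(\<And>k. Q $ k \<bullet> z = 0) \<Longrightarrow> c i \<bullet> z = 0"
proof -
  have on: "Q $ k \<bullet> Q $ l = (if k = l then 1 else 0)" for k l
    using Q by (simp add: orthonormal_rows_def)
  \<comment> \<open>Only the rows in which a competitor differs from \<open>Q\<close> matter.\<close>
  have local_max: "(\<Sum>k\<in>I. c k \<bullet> R $ k) \<le> (\<Sum>k\<in>I. c k \<bullet> Q $ k)"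
    if "R \<in> orthonormal_rows" "\<And>k. k \<notin> I \<Longrightarrow> R $ k = Q $ k" for R I
  proof -
    have "(\<Sum>k\<in>UNIV. c k \<bullet> S $ k) = (\<Sum>k\<in>I. c k \<bullet> S $ k) + (\<Sum>k\<in>-I. c k \<bullet> S $ k)" for S :: "real^'n^'m"
      by (subst sum.union_disjoint[symmetric]) auto
    moreover have "(\<Sum>k\<in>-I. c k \<bullet> R $ k) = (\<Sum>k\<in>-I. c k \<bullet> Q $ k)"
      using that by (intro sum.cong) auto
    ultimately show ?thesis using max[OF that(1)] by simp
  qed
  show "c i \<bullet> Q $ j = c j \<bullet> Q $ i"
  proof (cases "i = j")
    case False
    have "(c i \<bullet> Q $ i + c j \<bullet> Q $ j) * cos t + (c i \<bullet> Q $ j - c j \<bullet> Q $ i) * sin t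
        \<le> c i \<bullet> Q $ i + c j \<bullet> Q $ j" for t
    proof -
      define R where "R = (\<chi> k. if k = i then cos t *\<^sub>R Q $ i + sin t *\<^sub>R Q $ j
        else if k = j then cos t *\<^sub>R Q $ j - sin t *\<^sub>R Q $ i else Q $ k)"
      have "cos t * cos t + sin t * sin t = 1" 
        using sin_cos_squared_add2[of t] by (simp add: power2_eq_square)
      then have "R \<in> orthonormal_rows"
        using False by (auto simp: orthonormal_rows_def R_def inner_add inner_diff on)
      then have "(\<Sum>k\<in>{i,j}. c k \<bullet> R $ k) \<le> (\<Sum>k\<in>{i,j}. c k \<bullet> Q $ k)"
        by (rule local_max) (simp add: R_def)
      then show ?thesis using False by (simp add: R_def inner_add inner_diff algebra_simps)
    qed
    then show ?thesis using cos_sin_max_zero by fastforce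
  qed simp
  show "c i \<bullet> Q $ i \<ge> 0"
  proof -
    define R where "R = (\<chi> k. if k = i then - Q $ i else Q $ k)"
    have "R \<in> orthonormal_rows" by (auto simp: orthonormal_rows_def R_def on)
    then have "(\<Sum>k\<in>{i}. c k \<bullet> R $ k) \<le> (\<Sum>k\<in>{i}. c k \<bullet> Q $ k)"
      by (rule local_max) (simp add: R_def)
    then show ?thesis by (simp add: R_def)
  qed
  show "c i \<bullet> z = 0" if z: "\<And>k. Q $ k \<bullet> z = 0"
  proof (cases "z = 0")
    case False
    define y where "y = z /\<^sub>R norm z"
    have y: "y \<bullet> y = 1" "Q $ k \<bullet> y = 0" "y \<bullet> Q $ k = 0" for k
      using False z by (auto simp: y_def dot_square_norm power2_eq_square inner_commute[of z])
    have "(c i \<bullet> Q $ i) * cos t + (c i \<bullet> y) * sin t \<le> c i \<bullet> Q $ i" for t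
    proof -
      define R where "R = (\<chi> k. if k = i then cos t *\<^sub>R Q $ i + sin t *\<^sub>R y else Q $ k)"
      have "cos t * cos t + sin t * sin t = 1" 
        using sin_cos_squared_add2[of t] by (simp add: power2_eq_square)
      then have "R \<in> orthonormal_rows"
        by (auto simp: orthonormal_rows_def R_def inner_add on y)
      then have "(\<Sum>k\<in>{i}. c k \<bullet> R $ k) \<le> (\<Sum>k\<in>{i}. c k \<bullet> Q $ k)"
        by (rule local_max) (simp add: R_def)
      then show ?thesis by (simp add: R_def inner_add algebra_simps)
    qed
    then have "c i \<bullet> y = 0" by (rule cos_sin_max_zero)
    then show ?thesis using False by (simp add: y_def)
  qed simp
qed

text \<open>
  Maximise \<open>\<Sum>i. d i * (P $ i \<bullet> (A *v Q $ i))\<close> over all \<open>P\<close> and \<open>Q\<close> with orthonormal rows, where the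
  weights \<open>d i\<close> are positive and strictly decreasing. Put \<open>b i j = P $ i \<bullet> (A *v Q $ j)\<close>. The
  symmetry conditions in \<open>P\<close> and in \<open>Q\<close> read \<open>d i * b j i = d j * b i j\<close> and
  \<open>d i * b i j = d j * b j i\<close>, so that \<open>(d i)\<^sup>2 * b i j = (d j)\<^sup>2 * b i j\<close> and \<open>b\<close> is diagonal because
  the weights are distinct. Its diagonal is nonnegative by the sign condition, and it decreases
  because exchanging two rows of \<open>P\<close> and of \<open>Q\<close> simultaneously cannot increase the sum. The
  last condition says that \<open>A\<close> vanishes on the orthogonal complement of the rows of \<open>Q\<close>, which is
  what recovers \<open>A\<close> from \<open>b\<close> when there are more columns than rows.
\<close>
lemma svd_exists:
  fixes A :: "real^'n^'m"
  assumes "CARD('m) \<le> CARD('n)"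
  shows "\<exists>U s V. is_svd A U s V"
proof -
  define d :: "'m \<Rightarrow> real" where "d i = 1 / real (diag_index i)" for i
  have d_pos: "d i > 0" for i by (simp add: d_def diag_index_def)
  have d_less: "d j < d i" if "diag_index i < diag_index j" for i j
    using that by (simp add: d_def diag_index_def frac_less2)
  define \<Phi> :: "(real^'m^'m) \<times> (real^'n^'m) \<Rightarrow> real"
    where "\<Phi> = (\<lambda>(P, Q). \<Sum>i\<in>UNIV. d i * (P $ i \<bullet> (A *v Q $ i)))"
  let ?S = "(orthonormal_rows :: (real^'m^'m) set) \<times> (orthonormal_rows :: (real^'n^'m) set)"
  have "\<exists>x\<in>?S. \<forall>y\<in>?S. \<Phi> y \<le> \<Phi> x"
  proof (rule continuous_attains_sup)
    show "compact ?S" by (intro compact_Times compact_orthonormal_rows)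
    show "?S \<noteq> {}" using assms by (simp add: orthonormal_rows_nonempty)
    show "continuous_on ?S \<Phi>"
      unfolding \<Phi>_def split_def
      by (intro continuous_intros matrix_vector_mult_linear_continuous_on
          continuous_on_compose2[OF matrix_vector_mult_linear_continuous_on]) auto
  qed
  then obtain P Q where P: "P \<in> orthonormal_rows" and Q: "Q \<in> orthonormal_rows"
    and max: "\<And>P' Q'. P' \<in> orthonormal_rows \<Longrightarrow> Q' \<in> orthonormal_rows \<Longrightarrow> \<Phi> (P', Q') \<le> \<Phi> (P, Q)"
    by fast
  define b where "b i j = P $ i \<bullet> (A *v Q $ j)" for i j
  have maxP: "(\<Sum>k\<in>UNIV. (d k *\<^sub>R (A *v Q $ k)) \<bullet> R $ k) \<le> (\<Sum>k\<in>UNIV. (d k *\<^sub>R (A *v Q $ k)) \<bullet> P $ k)"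
    if "R \<in> orthonormal_rows" for R
    using max[OF that Q] by (simp add: \<Phi>_def inner_commute)
  have adj: "(d k *\<^sub>R (transpose A *v P $ k)) \<bullet> z = d k * (P $ k \<bullet> (A *v z))" for k z
    by (simp add: dot_lmul_matrix)
  have maxQ: "(\<Sum>k\<in>UNIV. (d k *\<^sub>R (transpose A *v P $ k)) \<bullet> R $ k)
      \<le> (\<Sum>k\<in>UNIV. (d k *\<^sub>R (transpose A *v P $ k)) \<bullet> Q $ k)"
    if "R \<in> orthonormal_rows" for R
    using max[OF P that] unfolding adj by (simp add: \<Phi>_def)
  have offdiag: "b i j = 0" if "i \<noteq> j" for i j
  proof -
    have 1: "d i * b j i = d j * b i j"
      using orthonormal_rows_linear_max(1)[OF P maxP, of i j] by (simp add: b_def inner_commute)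
    have 2: "d i * b i j = d j * b j i"
      using orthonormal_rows_linear_max(1)[OF Q maxQ, of i j] unfolding adj by (simp add: b_def)
    have "d i * d i * b i j = d j * (d i * b j i)" using 2 by simp
    also have "\<dots> = d j * d j * b i j" using 1 by simp
    finally have "(d i * d i - d j * d j) * b i j = 0" by (simp add: algebra_simps)
    moreover have "d i \<noteq> d j"
      using that inj_diag_index[where 'm='m] d_less by (metis injD less_irrefl linorder_neqE_nat)
    then have "d i * d i \<noteq> d j * d j"
      using d_pos by (metis less_eq_real_def power2_eq_iff_nonneg power2_eq_square)
    ultimately show ?thesis by simp
  qed
  have diag_nonneg: "b i i \<ge> 0" for i
    using orthonormal_rows_linear_max(2)[OF P maxP, of i] d_pos[of i]
    by (simp add: b_def inner_commute zero_le_mult_iff)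
  have diag_antimono: "b j j \<le> b i i" if "diag_index i < diag_index j" for i j
  proof -
    define \<tau> where "\<tau> = Transposition.transpose i j"
    have "bij \<tau>" by (simp add: \<tau>_def)
    then have \<tau>: "\<tau> k = \<tau> l \<longleftrightarrow> k = l" for k l by (simp add: bij_is_inj inj_eq)
    have "(\<chi> k. P $ \<tau> k) \<in> orthonormal_rows" "(\<chi> k. Q $ \<tau> k) \<in> orthonormal_rows"
      using P Q by (simp_all add: orthonormal_rows_def \<tau>)
    from max[OF this] have "(\<Sum>k\<in>UNIV. d k * b (\<tau> k) (\<tau> k)) \<le> (\<Sum>k\<in>UNIV. d k * b k k)"
      by (simp add: \<Phi>_def b_def)
    moreover have "(\<Sum>k\<in>UNIV. h k) = (\<Sum>k\<in>{i,j}. h k) + (\<Sum>k\<in>-{i,j}. h k)" for h :: "'m \<Rightarrow> real"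
      by (subst sum.union_disjoint[symmetric]) (auto simp: Compl_partition)
    moreover have "(\<Sum>k\<in>-{i,j}. d k * b (\<tau> k) (\<tau> k)) = (\<Sum>k\<in>-{i,j}. d k * b k k)"
      by (intro sum.cong) (auto simp: \<tau>_def Transposition.transpose_def)
    ultimately have swap: "(\<Sum>k\<in>{i,j}. d k * b (\<tau> k) (\<tau> k)) \<le> (\<Sum>k\<in>{i,j}. d k * b k k)" by simp
    then have "0 \<le> (d i - d j) * (b i i - b j j)"
    proof (cases "i = j")
      case False
      with swap show ?thesis by (simp add: \<tau>_def algebra_simps)
    qed simp
    then show ?thesis using d_less[OF that] by (simp add: zero_le_mult_iff)
  qed
  have PP: "P ** transpose P = mat 1" "transpose P ** P = mat 1" and QQ: "Q ** transpose Q = mat 1"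
    using P Q matrix_left_right_inverse by (auto simp: orthonormal_rows_iff)
  \<comment> \<open>\<open>z\<close> below is the component of \<open>x\<close> orthogonal to the rows of \<open>Q\<close>, on which \<open>A\<close> vanishes.\<close>
  have proj: "A ** (transpose Q ** Q) = A"
  proof (rule matrix_eq[THEN iffD2], rule allI)
    fix x
    define z where "z = x - (transpose Q ** Q) *v x"
    have "Q *v z = Q *v x - (Q ** transpose Q) *v (Q *v x)"
      by (simp add: z_def matrix_vector_mult_diff_distrib matrix_vector_mul_assoc matrix_mul_assoc)
    then have "Q *v z = 0" by (simp add: QQ)
    then have "Q $ k \<bullet> z = 0" for k by (simp add: vec_eq_iff matrix_vector_mul_component)
    then have "d k * (P $ k \<bullet> (A *v z)) = 0" for k
      using orthonormal_rows_linear_max(3)[OF Q maxQ, of z k] unfolding adj by simp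
    then have "P *v (A *v z) = 0"
      using d_pos by (simp add: vec_eq_iff matrix_vector_mul_component less_imp_neq[symmetric])
    then have "(transpose P ** P) *v (A *v z) = 0"
      by (simp flip: matrix_vector_mul_assoc)
    then have "A *v z = 0" by (simp add: PP)
    then show "(A ** (transpose Q ** Q)) *v x = A *v x"
      by (simp add: z_def matrix_vector_mult_diff_distrib flip: matrix_vector_mul_assoc)
  qed
  define s where "s n = (let i = inv diag_index n in b i i)" for n
  have s: "s (diag_index i) = b i i" for i
    by (simp add: s_def inj_diag_index)
  have B: "P ** A ** transpose Q = diag_mat s"
  proof -
    have "(P ** A) $ i = P $ i v* A" for i
      by (simp add: vec_eq_iff matrix_matrix_mult_def vector_matrix_mult_def mult.commute)
    then have "(P ** A ** transpose Q) $ i $ j = b i j" for i j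
      by (simp add: matrix_mult_transpose_entry b_def dot_lmul_matrix)
    then show ?thesis by (simp add: vec_eq_iff diag_mat_entry s offdiag)
  qed
  have "A = transpose P ** diag_mat s ** Q"
    unfolding B[symmetric] using PP proj by (metis matrix_mul_assoc matrix_mul_lid)
  moreover have "antimono_on {1..CARD('m)} s"
  proof (rule monotone_onI)
    fix k l assume "k \<in> {1..CARD('m)}" "l \<in> {1..CARD('m)}" "k \<le> l"
    then show "s l \<le> s k"
      by (metis diag_antimono diag_index_cases le_neq_implies_less order_refl s)
  qed
  moreover have "0 \<le> s k" if "k \<in> {1..CARD('m)}" for k
    using that diag_nonneg by (metis diag_index_cases s)
  ultimately have "is_svd A (transpose P) s (transpose Q)"
    using PP QQ by (simp add: is_svd_def orthogonal_matrix_def transpose_transpose)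
  then show ?thesis by blast
qed

section \<open>Uniqueness of the singular values, rank, and limits\<close>

lemma is_svd_cong:
  fixes A :: "real^'n^'m"
  assumes "\<And>n. n \<in> {1..CARD('m)} \<Longrightarrow> s n = t n"
  shows "is_svd A U s V \<longleftrightarrow> is_svd A U t V"
  using assms diag_mat_cong[of s t, where 'm='m]
  by (auto simp: is_svd_def monotone_on_def)

lemma svd_gram:
  assumes "is_svd A U s V"
  shows "A ** transpose A = U ** diag_mat (\<lambda>n. (s n)\<^sup>2) ** transpose U"
proof -
  have "A ** transpose A = U ** diag_mat s ** (transpose V ** V) ** diag_mat s ** transpose U"
  proof -
    have "A = U ** diag_mat s ** transpose V" using assms by (simp add: is_svd_def)
    then show ?thesis
      by (metis matrix_mul_assoc matrix_transpose_mul transpose_diag_mat transpose_transpose)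
  qed
  also have "\<dots> = U ** (diag_mat s ** diag_mat s) ** transpose U"
  proof -
    have "transpose V ** V = mat 1" using assms by (simp add: is_svd_def)
    then show ?thesis by (simp add: matrix_mul_assoc)
  qed
  also have "diag_mat s ** diag_mat s = diag_mat (\<lambda>n. (s n)\<^sup>2)"
    by (simp add: vec_eq_iff matrix_mult_diag_mat diag_mat_entry power2_eq_square)
  finally show ?thesis .
qed

text \<open>
  A decreasing sequence is determined by the number of its entries above each threshold.
\<close>
lemma antimono_on_greater_iff:
  fixes s :: "nat \<Rightarrow> real"
  assumes "antimono_on {1..m} s" "n \<in> {1..m}"
  shows "t < s n \<longleftrightarrow> n \<le> card {k \<in> {1..m}. t < s k}"
proof
  assume "t < s n"
  then have "{1..n} \<subseteq> {k \<in> {1..m}. t < s k}"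
    using assms by (fastforce dest: monotone_onD)
  then show "n \<le> card {k \<in> {1..m}. t < s k}"
    using card_mono[of "{k \<in> {1..m}. t < s k}" "{1..n}"] by simp
next
  assume *: "n \<le> card {k \<in> {1..m}. t < s k}"
  show "t < s n"
  proof (rule ccontr)
    assume "\<not> t < s n"
    then have "s k \<le> t" if "k \<in> {n..m}" for k
      using assms that monotone_onD[OF assms(1), of n k] by simp
    then have "{k \<in> {1..m}. t < s k} \<subseteq> {1..<n}"
      by (force simp: not_less[symmetric])
    then have "card {k \<in> {1..m}. t < s k} \<le> n - 1"
      using card_mono[of "{1..<n}"] by fastforce
    then show False using * assms(2) by auto
  qed
qed

text \<open>
  The orthogonal matrix \<open>W\<close> that relates the left factors intertwines the two diagonal forms of
  \<open>A ** transpose A\<close>, so that \<open>W $ i $ j\<close> can be nonzero only where \<open>s\<close> at \<open>j\<close> equals \<open>s'\<close> at \<open>i\<close>. The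
  squares of the entries of \<open>W\<close> have row and column sums \<open>1\<close>; summing those that belong to values
  above \<open>t\<close>, once by columns and once by rows, shows that \<open>s\<close> and \<open>s'\<close> have equally many entries
  above \<open>t\<close>.
\<close>
lemma svd_values_unique:
  fixes A :: "real^'n^'m"
  assumes svd: "is_svd A U s V" and svd': "is_svd A U' s' V'" and n: "n \<in> {1..CARD('m)}"
  shows "s n = s' n"
proof -
  have U: "transpose U ** U = mat 1" "U ** transpose U = mat 1"
    and U': "transpose U' ** U' = mat 1" "U' ** transpose U' = mat 1"
    using svd svd' by (auto simp: is_svd_def orthogonal_matrix_def)
  define W where "W = transpose U' ** U"
  have "W ** diag_mat (\<lambda>n. (s n)\<^sup>2) = transpose U' ** (A ** transpose A) ** U"
    unfolding svd_gram[OF svd] W_def using U by (simp add: matrix_mul_assoc[symmetric])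
  also have "\<dots> = diag_mat (\<lambda>n. (s' n)\<^sup>2) ** W"
    unfolding svd_gram[OF svd'] W_def using U' by (simp add: matrix_mul_assoc)
  finally have "W $ i $ j * (s (diag_index j))\<^sup>2 = (s' (diag_index i))\<^sup>2 * W $ i $ j" for i j
    by (metis matrix_mult_diag_mat diag_mat_matrix_mult)
  moreover have "s (diag_index i) \<ge> 0" "s' (diag_index i) \<ge> 0" for i :: 'm
    using svd svd' diag_index_in_range[of i] unfolding is_svd_def by blast+
  ultimately have W_nz: "s (diag_index j) = s' (diag_index i)" if "W $ i $ j \<noteq> 0" for i j
    using that by (metis mult.commute mult_cancel_left power2_eq_iff_nonneg)
  have W: "W ** transpose W = mat 1" "transpose W ** W = mat 1"
    using U U' unfolding W_def
    by (simp_all add: matrix_transpose_mul transpose_transpose)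
      (metis matrix_mul_assoc matrix_mul_rid)+
  have row: "(\<Sum>j\<in>UNIV. (W $ i $ j)\<^sup>2) = 1" for i
    using arg_cong[OF W(1), of "\<lambda>M. M $ i $ i"]
    by (simp add: matrix_matrix_mult_def transpose_def mat_def power2_eq_square)
  have col: "(\<Sum>i\<in>UNIV. (W $ i $ j)\<^sup>2) = 1" for j
    using arg_cong[OF W(2), of "\<lambda>M. M $ j $ j"]
    by (simp add: matrix_matrix_mult_def transpose_def mat_def power2_eq_square)
  have card_eq: "real (card {k \<in> {1..CARD('m)}. t < r k}) = (\<Sum>j::'m\<in>UNIV. of_bool (t < r (diag_index j)))"
    for t and r :: "nat \<Rightarrow> real"
  proof -
    have "(\<Sum>j::'m\<in>UNIV. of_bool (t < r (diag_index j))) = (\<Sum>k\<in>{1..CARD('m)}. of_bool (t < r k) :: real)"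
      by (rule sum.reindex_bij_betw[OF bij_diag_index])
    then show ?thesis by (simp add: Int_def)
  qed
  have count: "card {k \<in> {1..CARD('m)}. t < s k} = card {k \<in> {1..CARD('m)}. t < s' k}" for t
  proof -
    have "real (card {k \<in> {1..CARD('m)}. t < s k})
        = (\<Sum>j\<in>UNIV. \<Sum>i\<in>UNIV. (W $ i $ j)\<^sup>2 * of_bool (t < s (diag_index j)))"
      unfolding card_eq by (simp add: col flip: sum_distrib_right)
    also have "\<dots> = (\<Sum>j\<in>UNIV. \<Sum>i\<in>UNIV. (W $ i $ j)\<^sup>2 * of_bool (t < s' (diag_index i)))"
      using W_nz by (intro sum.cong refl) (metis mult_zero_left power_zero_numeral)
    also have "\<dots> = real (card {k \<in> {1..CARD('m)}. t < s' k})"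
      unfolding card_eq by (subst sum.swap) (simp add: row flip: sum_distrib_right)
    finally show ?thesis by simp
  qed
  have "t < s n \<longleftrightarrow> t < s' n" for t
    using antimono_on_greater_iff[of "CARD('m)" s n t] antimono_on_greater_iff[of "CARD('m)" s' n t]
      svd svd' n count[of t] by (simp add: is_svd_def)
  then show ?thesis by (metis less_irrefl linorder_neqE)
qed

lemma sing_val_svd:
  fixes A :: "real^'n^'m"
  assumes "is_svd A U s V"
  shows "n \<in> {1..CARD('m)} \<Longrightarrow> sing_val A n = s n"
    and "n \<notin> {1..CARD('m)} \<Longrightarrow> sing_val A n = 0"
proof -
  define t where "t n = (if n \<in> {1..CARD('m)} then s n else 0)" for n
  have "is_svd A U t V" using assms is_svd_cong[of s t A] by (simp add: t_def)
  have "sing_val A = t" unfolding sing_val_def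
  proof (rule the_equality)
    show "(\<exists>U V. is_svd A U t V) \<and> (\<forall>i. i \<notin> {1..CARD('m)} \<longrightarrow> t i = 0)"
      using \<open>is_svd A U t V\<close> by (auto simp: t_def)
  next
    fix t' assume t': "(\<exists>U V. is_svd A U t' V) \<and> (\<forall>i. i \<notin> {1..CARD('m)} \<longrightarrow> t' i = 0)"
    then obtain U' V' where "is_svd A U' t' V'" by blast
    then have "t' n = t n" if "n \<in> {1..CARD('m)}" for n
      using \<open>is_svd A U t V\<close> that by (rule svd_values_unique)
    moreover have "t' n = t n" if "n \<notin> {1..CARD('m)}" for n
      using t'[THEN conjunct2, rule_format, OF that] that by (simp only: t_def if_False)
    ultimately show "t' = t" by blast
  qed
  then show "n \<in> {1..CARD('m)} \<Longrightarrow> sing_val A n = s n" "n \<notin> {1..CARD('m)} \<Longrightarrow> sing_val A n = 0"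
    unfolding t_def by auto
qed

lemma svd_sing_val:
  fixes A :: "real^'n^'m"
  assumes "CARD('m) \<le> CARD('n)"
  obtains U V where "is_svd A U (sing_val A) V"
proof -
  obtain U s V where "is_svd A U s V" using svd_exists[OF assms] by blast
  then have "is_svd A U (sing_val A) V"
    by (subst is_svd_cong[of "sing_val A" s]) (simp_all add: sing_val_svd(1))
  then show thesis by (rule that)
qed

lemma sing_val_antimono:
  fixes A :: "real^'n^'m"
  assumes "CARD('m) \<le> CARD('n)"
  shows "antimono_on {1..CARD('m)} (sing_val A)"
proof -
  obtain U V where "is_svd A U (sing_val A) V" using svd_sing_val[OF assms] .
  then show ?thesis by (simp add: is_svd_def)
qed

lemma sing_val_nonneg:
  fixes A :: "real^'n^'m"
  assumes "CARD('m) \<le> CARD('n)" "n \<in> {1..CARD('m)}"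
  shows "sing_val A n \<ge> 0"
proof -
  obtain U V where "is_svd A U (sing_val A) V" using svd_sing_val[OF assms(1)] .
  then show ?thesis using assms(2) unfolding is_svd_def by blast
qed

lemma pos_idx_eq:
  fixes A :: "real^'n^'m"
  assumes "CARD('m) \<le> CARD('n)"
  shows "pos_idx A = {1..card (pos_idx A)}"
proof -
  have le: "card (pos_idx A) \<le> CARD('m)"
    using card_mono[of "{1..CARD('m)}" "pos_idx A"] by (simp add: pos_idx_def subset_iff)
  have iff: "n \<in> pos_idx A \<longleftrightarrow> n \<le> card (pos_idx A)" if "n \<in> {1..CARD('m)}" for n
    using antimono_on_greater_iff[OF sing_val_antimono[OF assms, of A] that, of 0] that
    unfolding pos_idx_def by blast
  have "n \<in> pos_idx A \<longleftrightarrow> n \<in> {1..card (pos_idx A)}" for n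
  proof (cases "n \<in> {1..CARD('m)}")
    case True
    then show ?thesis using iff by simp
  next
    case False
    moreover have "n \<notin> pos_idx A" using False unfolding pos_idx_def by blast
    ultimately show ?thesis using le by auto
  qed
  then show ?thesis by blast
qed

lemma zero_idx_eq:
  fixes A :: "real^'n^'m"
  assumes "CARD('m) \<le> CARD('n)"
  shows "zero_idx A = {1..CARD('m)} - pos_idx A"
  using sing_val_nonneg[OF assms, of _ A] by (force simp: zero_idx_def pos_idx_def)

text \<open>
  The outer factors of a singular value decomposition are injective and surjective, so that the rank
  is that of the diagonal factor, whose range is a coordinate subspace.
\<close>
lemma rank_eq_card_pos_idx:
  fixes A :: "real^'n^'m"
  assumes "CARD('m) \<le> CARD('n)"
  shows "rank A = card (pos_idx A)"
proof -
  obtain U V where svd: "is_svd A U (sing_val A) V" using svd_sing_val[OF assms] .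
  let ?D = "diag_mat (sing_val A) :: real^'m^'m"
  let ?I = "{i :: 'm. sing_val A (diag_index i) \<noteq> 0}"
  have V: "transpose V ** V = mat 1" and U: "transpose U ** U = mat 1"
    and A: "A = U ** ?D ** transpose V"
    using svd by (auto simp: is_svd_def orthogonal_matrix_def)
  have surj: "range ((*v) (transpose V)) = UNIV"
  proof (rule surjI)
    fix x show "transpose V *v (V *v x) = x" 
      by (simp only: matrix_vector_mul_assoc V matrix_vector_mul_lid)
  qed
  have inj: "inj ((*v) U)"
  proof (rule inj_on_inverseI)
    fix x show "transpose U *v (U *v x) = x" 
      by (simp only: matrix_vector_mul_assoc U matrix_vector_mul_lid)
  qed
  have "A *v x = U *v (?D *v (transpose V *v x))" for x
    by (subst A) (simp only: matrix_vector_mul_assoc matrix_mul_assoc)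
  then have "(*v) A = (*v) U \<circ> (*v) ?D \<circ> (*v) (transpose V)"
    by (intro ext) (simp only: comp_apply)
  then have "range ((*v) A) = (*v) U ` (*v) ?D ` range ((*v) (transpose V))"
    by (simp only: image_comp comp_assoc)
  then have "range ((*v) A) = (*v) U ` range ((*v) ?D)"
    by (simp only: surj)
  then have "rank A = dim (range ((*v) ?D))"
    unfolding rank_dim_range
    by (simp only:) (rule dim_image_eq, simp_all add: inj_on_subset[OF inj])
  also have "range ((*v) ?D) = {x. \<forall>i. i \<notin> ?I \<longrightarrow> x $ i = 0}"
  proof safe
    fix x :: "real^'m" assume x: "\<forall>i. i \<notin> ?I \<longrightarrow> x $ i = 0"
    have "x = ?D *v (\<chi> i. x $ i / sing_val A (diag_index i))"
      using x by (auto simp: vec_eq_iff diag_mat_vector_mult)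
    then show "x \<in> range ((*v) ?D)" by (rule range_eqI)
  qed (simp add: diag_mat_vector_mult)
  also have "dim \<dots> = card ?I"
    using dim_substandard_cart[of ?I, where 'a=real] by (simp add: dim_vec_eq)
  also have "\<dots> = card (pos_idx A)"
  proof (rule bij_betw_same_card)
    have "diag_index ` ?I = pos_idx A"
    proof safe
      fix i :: 'm assume "sing_val A (diag_index i) \<noteq> 0"
      then show "diag_index i \<in> pos_idx A"
        using sing_val_nonneg[OF assms diag_index_in_range, of A i] diag_index_in_range[of i]
        unfolding pos_idx_def by simp
    next
      fix n assume "n \<in> pos_idx A"
      then have n: "n \<in> {1..CARD('m)}" "sing_val A n \<noteq> 0" by (auto simp: pos_idx_def)
      from n(1) obtain i :: 'm where "n = diag_index i" by (rule diag_index_cases)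
      then show "n \<in> diag_index ` ?I" using n(2) by blast
    qed
    then show "bij_betw diag_index ?I (pos_idx A)"
      using inj_diag_index by (auto intro: bij_betw_imageI inj_on_subset)
  qed
  finally show ?thesis .
qed

text \<open>
  A compactness substitute for perturbation bounds on singular values. The factors of singular value
  decompositions lie in a compact set and hence converge along a subsequence; the diagonal
  \<open>transpose U ** X ** V\<close> then converges too, and the limits form a singular value
  decomposition of \<open>A\<close>, whose diagonal is the one of \<open>A\<close> by uniqueness.
\<close>
lemma sing_val_subseq_tendsto:
  fixes A :: "real^'n^'m"
  assumes mn: "CARD('m) \<le> CARD('n)" and lim: "X \<longlonglongrightarrow> A"
  obtains r where "strict_mono r"
    "\<And>n. n \<in> {1..CARD('m)} \<Longrightarrow> (\<lambda>k. sing_val (X (r k)) n) \<longlonglongrightarrow> sing_val A n"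
proof -
  have "\<exists>U V. is_svd (X k) U (sing_val (X k)) V" for k
  proof -
    obtain U V where "is_svd (X k) U (sing_val (X k)) V" using svd_sing_val[OF mn] .
    then show ?thesis by blast
  qed
  then obtain U V where svd: "\<And>k. is_svd (X k) (U k) (sing_val (X k)) (V k)" by metis
  define P where "P k = (transpose (U k), transpose (V k))" for k
  let ?S = "(orthonormal_rows :: (real^'m^'m) set) \<times> (orthonormal_rows :: (real^'n^'m) set)"
  have "P k \<in> ?S" for k
    using svd[of k]
    by (simp add: P_def orthonormal_rows_iff is_svd_def orthogonal_matrix_def transpose_transpose)
  moreover have "compact ?S" by (intro compact_Times compact_orthonormal_rows)
  ultimately obtain L r where L: "L \<in> ?S" and r: "strict_mono r" and "(P \<circ> r) \<longlonglongrightarrow> L"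
    unfolding compact_def by blast
  define U' V' where "U' = transpose (fst L)" and "V' = transpose (snd L)"
  have "(\<lambda>k. transpose (U (r k))) \<longlonglongrightarrow> transpose U'" "(\<lambda>k. transpose (V (r k))) \<longlonglongrightarrow> transpose V'"
    using tendsto_fst[OF \<open>(P \<circ> r) \<longlonglongrightarrow> L\<close>] tendsto_snd[OF \<open>(P \<circ> r) \<longlonglongrightarrow> L\<close>]
    by (simp_all add: P_def U'_def V'_def transpose_transpose o_def)
  from this[THEN tendsto_vec_nth, THEN tendsto_vec_nth]
  have U_lim: "(\<lambda>k. U (r k) $ i $ j) \<longlonglongrightarrow> U' $ i $ j"
    and V_lim: "(\<lambda>k. V (r k) $ h $ j) \<longlonglongrightarrow> V' $ h $ j" for i j h
    by (simp_all add: transpose_def)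
  have X_lim: "(\<lambda>k. X (r k) $ i $ h) \<longlonglongrightarrow> A $ i $ h" for i h
    using LIMSEQ_subseq_LIMSEQ[OF lim r, THEN tendsto_vec_nth, THEN tendsto_vec_nth]
    by (simp add: o_def)
  have U': "transpose U' ** U' = mat 1" "U' ** transpose U' = mat 1"
    and V': "transpose V' ** V' = mat 1"
    using L matrix_left_right_inverse[of "fst L" "transpose (fst L)"]
    by (simp_all add: U'_def V'_def orthonormal_rows_iff transpose_transpose mem_Times_iff)
  have D_eq: "diag_mat (sing_val (X k)) = transpose (U k) ** X k ** V k" for k
  proof -
    have U: "transpose (U k) ** U k = mat 1" and V: "transpose (V k) ** V k = mat 1"
      and X: "X k = U k ** diag_mat (sing_val (X k)) ** transpose (V k)"
      using svd[of k] by (auto simp: is_svd_def orthogonal_matrix_def)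
    have "transpose (U k) ** X k ** V k
        = transpose (U k) ** (U k ** diag_mat (sing_val (X k)) ** transpose (V k)) ** V k"
      by (rule arg_cong[OF X])
    also have "\<dots> = (transpose (U k) ** U k) ** diag_mat (sing_val (X k)) ** (transpose (V k) ** V k)"
      by (simp only: matrix_mul_assoc)
    also have "\<dots> = diag_mat (sing_val (X k))"
      by (simp add: U V)
    finally show ?thesis by (rule sym)
  qed
  define D where "D = transpose U' ** A ** V'"
  have D_lim: "(\<lambda>k. diag_mat (sing_val (X (r k))) $ i $ j) \<longlonglongrightarrow> D $ i $ j" for i j
    unfolding D_eq D_def
    by (simp add: matrix_matrix_mult_def transpose_def)
      (intro tendsto_sum tendsto_mult tendsto_const U_lim V_lim X_lim)
  define s where "s n = (let i = inv diag_index n in D $ i $ i)" for n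
  have s_diag: "s (diag_index i) = D $ i $ i" for i
    by (simp add: s_def inj_diag_index)
  have s_lim: "(\<lambda>k. sing_val (X (r k)) n) \<longlonglongrightarrow> s n" if n: "n \<in> {1..CARD('m)}" for n
  proof -
    obtain i :: 'm where "n = diag_index i" using n by (rule diag_index_cases)
    then show ?thesis using D_lim[of i i] by (simp add: s_diag diag_mat_entry)
  qed
  have "D $ i $ j = 0" if "i \<noteq> j" for i j
    using D_lim[of i j] that by (simp add: diag_mat_entry LIMSEQ_const_iff)
  then have D_diag: "D = diag_mat s"
    by (simp add: vec_eq_iff diag_mat_entry s_diag)
  have "A $ i $ h = (U' ** D ** transpose V') $ i $ h" for i h
  proof (rule LIMSEQ_unique[OF X_lim])
    have "(\<lambda>k. (U (r k) ** diag_mat (sing_val (X (r k))) ** transpose (V (r k))) $ i $ h)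
        \<longlonglongrightarrow> (U' ** D ** transpose V') $ i $ h"
      unfolding matrix_matrix_mult_def transpose_def
      by (simp, intro tendsto_sum tendsto_mult U_lim V_lim D_lim)
    moreover have "U (r k) ** diag_mat (sing_val (X (r k))) ** transpose (V (r k)) = X (r k)" for k
      using svd[of "r k"] unfolding is_svd_def by (elim conjE) (rule sym, assumption)
    ultimately show "(\<lambda>k. X (r k) $ i $ h) \<longlonglongrightarrow> (U' ** D ** transpose V') $ i $ h"
      by (simp only:)
  qed
  then have A_eq: "A = U' ** diag_mat s ** transpose V'"
    unfolding vec_eq_iff D_diag by blast
  have "s l \<le> s k" if "k \<in> {1..CARD('m)}" "l \<in> {1..CARD('m)}" "k \<le> l" for k l
    using monotone_onD[OF sing_val_antimono[OF mn] that]
    by (intro LIMSEQ_le[OF s_lim s_lim]) (use that in auto)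
  moreover have "0 \<le> s k" if "k \<in> {1..CARD('m)}" for k
    using sing_val_nonneg[OF mn that] by (intro LIMSEQ_le_const[OF s_lim[OF that]]) auto
  ultimately have "is_svd A U' s V'"
    using U' V' A_eq by (auto simp: is_svd_def orthogonal_matrix_def intro!: monotone_onI)
  then have "sing_val A n = s n" if "n \<in> {1..CARD('m)}" for n
    using that by (rule sing_val_svd(1))
  then show thesis using s_lim by (intro that[OF r]) simp_all
qed

section \<open>Monotonicity of the perturbed singular values\<close>

text \<open>
  The invariant of the perturbation update. Although \<open>\<epsilon>\<close> starts out non-increasing, it does not
  remain so: the entries of positive singular values shrink by the factor \<open>\<mu>\<close>, while the others may
  stay as they are. What survives is monotonicity on either side of the jump, together with
  monotonicity of \<open>\<sigma> + \<epsilon>\<close>, the quantity on which the weights depend.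
\<close>
definition admissible_eps :: "real^'n^'m \<Rightarrow> (nat \<Rightarrow> real) \<Rightarrow> bool" where
  "admissible_eps A e \<longleftrightarrow>
     (\<forall>i\<in>{1..CARD('m)}. 0 < e i) \<and>
     antimono_on (pos_idx A) e \<and> antimono_on (zero_idx A) e \<and>
     antimono_on {1..CARD('m)} (\<lambda>i. sing_val A i + e i)"

lemma antimono_eps_imp_admissible:
  fixes A :: "real^'n^'m"
  assumes "CARD('m) \<le> CARD('n)" "\<forall>i\<in>{1..CARD('m)}. 0 < e i" "antimono_on {1..CARD('m)} e"
  shows "admissible_eps A e"
proof -
  have "antimono_on (pos_idx A) e" "antimono_on (zero_idx A) e"
    by (rule monotone_on_subset[OF assms(3)], simp add: pos_idx_def zero_idx_def subset_iff)+
  moreover have "antimono_on {1..CARD('m)} (\<lambda>i. sing_val A i + e i)"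
    using monotone_onD[OF assms(3)] monotone_onD[OF sing_val_antimono[OF assms(1), of A]]
    by (intro monotone_onI add_mono)
  ultimately show ?thesis using assms(2) by (simp add: admissible_eps_def)
qed

text \<open>
  Monotonicity of \<open>\<sigma> + \<epsilon>\<close> is automatic within each of the two blocks, so that the only inequality
  left to check is the one across the jump.
\<close>
lemma admissible_epsI:
  fixes A :: "real^'n^'m"
  assumes mn: "CARD('m) \<le> CARD('n)" and r: "r = card (pos_idx A)"
    and pos: "\<And>i. i \<in> {1..CARD('m)} \<Longrightarrow> 0 < e i"
    and anti_pos: "\<And>i j. 1 \<le> i \<Longrightarrow> i \<le> j \<Longrightarrow> j \<le> r \<Longrightarrow> e j \<le> e i"
    and anti_zero: "\<And>i j. r + 1 \<le> i \<Longrightarrow> i \<le> j \<Longrightarrow> j \<le> CARD('m) \<Longrightarrow> e j \<le> e i"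
    and jump: "r \<noteq> 0 \<Longrightarrow> r < CARD('m) \<Longrightarrow> e (r + 1) \<le> sing_val A r + e r"
  shows "admissible_eps A e"
proof -
  have P: "pos_idx A = {1..r}" using pos_idx_eq[OF mn, of A] r by simp
  have Z: "zero_idx A = {r+1..CARD('m)}" using zero_idx_eq[OF mn, of A] P by auto
  have sum: "sing_val A j + e j \<le> sing_val A i + e i"
    if ij: "i \<in> {1..CARD('m)}" "j \<in> {1..CARD('m)}" "i \<le> j" for i j
  proof (cases "j \<le> r \<or> r < i")
    case True
    then have "e j \<le> e i" using anti_pos[of i j] anti_zero[of i j] ij by auto
    then show ?thesis using monotone_onD[OF sing_val_antimono[OF mn] ij, of A] by simp
  next
    case False
    have "j \<in> zero_idx A" unfolding Z using False ij by simp
    then have "sing_val A j = 0" by (simp add: zero_idx_def)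
    moreover have "e j \<le> e (r + 1)" using False ij by (intro anti_zero) auto
    moreover have "e (r + 1) \<le> sing_val A r + e r" using False ij by (intro jump) auto
    moreover have "e r \<le> e i" using False ij by (intro anti_pos) auto
    moreover have "sing_val A r \<le> sing_val A i"
      using False ij by (intro monotone_onD[OF sing_val_antimono[OF mn]]) auto
    ultimately show ?thesis by simp
  qed
  have "antimono_on {1..r} e" "antimono_on {r+1..CARD('m)} e"
    by (rule monotone_onI, rule anti_pos anti_zero; simp)+
  moreover have "antimono_on {1..CARD('m)} (\<lambda>i. sing_val A i + e i)"
    by (rule monotone_onI) (rule sum)
  ultimately show ?thesis unfolding admissible_eps_def P Z using pos by blast
qed

text \<open>
  Both branches of the capping rule truncate \<open>\<epsilon>\<close> at one common level \<open>c\<close>. In the branch that leaves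
  \<open>\<epsilon>\<close> unchanged, the first entry of the block serves as level, because it is the largest one. This
  makes it evident that capping preserves order, and that it yields the inequality across the jump.
\<close>
lemma capped_eq_min:
  fixes e e' :: "nat \<Rightarrow> real" and \<tau>1 :: ereal
  assumes \<tau>1: "\<tau>1 = (if r = 0 then \<infinity> else ereal t)" and t: "r \<noteq> 0 \<Longrightarrow> 0 < t"
    and \<mu>: "0 < \<mu>" "\<mu> < 1"
    and pos: "\<And>i. i \<in> {r+1..b} \<Longrightarrow> 0 < e i"
    and anti: "\<And>i. i \<in> {r+1..b} \<Longrightarrow> e i \<le> e (r + 1)"
    and capped: "\<And>i. i \<in> {r+1..b} \<Longrightarrow> ereal (e' i) =
      (if \<tau>1 \<ge> ereal (e (r + 1)) then ereal (e i) else min (ereal (e i)) (ereal \<mu> * \<tau>1))"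
  obtains c where "0 < c" "r \<noteq> 0 \<Longrightarrow> c \<le> t" "\<And>i. i \<in> {r+1..b} \<Longrightarrow> e' i = min (e i) c"
proof (cases "r < b")
  case False
  show thesis by (rule that[of "if r = 0 then 1 else t"]) (use False t in auto)
next
  case True
  show thesis
  proof (cases "\<tau>1 \<ge> ereal (e (r + 1))")
    case le: True
    show thesis
    proof (rule that[of "e (r + 1)"])
      show "0 < e (r + 1)" using True pos by simp
      show "e (r + 1) \<le> t" if "r \<noteq> 0" using le that \<tau>1 by simp
      show "e' i = min (e i) (e (r + 1))" if "i \<in> {r+1..b}" for i
        using capped[OF that] anti[OF that] le by simp
    qed
  next
    case nle: False
    then have r: "r \<noteq> 0" by (cases "r = 0") (simp_all add: \<tau>1)
    show thesis
    proof (rule that[of "\<mu> * t"])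
      show "0 < \<mu> * t" using \<mu> t[OF r] by simp
      show "\<mu> * t \<le> t" using \<mu> t[OF r] by (simp add: mult_le_cancel_right1)
      show "e' i = min (e i) (\<mu> * t)" if "i \<in> {r+1..b}" for i
        using capped[OF that] nle r unfolding \<tau>1 by (simp flip: ereal_min)
    qed
  qed
qed

text \<open>
  On each piece of the index set on which the update uses one clause, it scales the entries by \<open>\<mu>\<close> or
  takes minima with one level, and both preserve order. When a block of the new support is made of
  two such pieces, the truncation of the second one at the last entry of the first one (\<open>e r\<close> when
  indices enter the support, \<open>e' r\<close> when they leave it) keeps the pieces in order. The level \<open>c\<close> of
  the capping rule does not exceed \<open>\<sigma> + \<epsilon>\<close> at the last positive index, which is the
  inequality across the jump.
\<close>
lemma eps_update_admissible:
  fixes A A' :: "real^'n^'m"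
  assumes mn: "CARD('m) \<le> CARD('n)" and \<mu>: "0 < \<mu>" "\<mu> < 1"
    and adm: "admissible_eps A e" and upd: "eps_update \<mu> A A' e e'"
  shows "admissible_eps A' e'"
proof -
  define r r' where "r = card (pos_idx A)" and "r' = card (pos_idx A')"
  define t where "t = sing_val A' r' + e' r'"
  define \<tau>1 where "\<tau>1 = (if r' = 0 then \<infinity> else ereal t)"
  define capped where "capped i \<longleftrightarrow> ereal (e' i) =
    (if \<tau>1 \<ge> ereal (e (r' + 1)) then ereal (e i) else min (ereal (e i)) (ereal \<mu> * \<tau>1))" for i
  have P: "pos_idx A = {1..r}" and P': "pos_idx A' = {1..r'}"
    using pos_idx_eq[OF mn, of A] pos_idx_eq[OF mn, of A'] by (simp_all add: r_def r'_def)
  have Z: "zero_idx A = {r+1..CARD('m)}" and Z': "zero_idx A' = {r'+1..CARD('m)}"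
    using zero_idx_eq[OF mn, of A] zero_idx_eq[OF mn, of A'] P P' by auto
  have "pos_idx A \<subseteq> {1..CARD('m)}" "pos_idx A' \<subseteq> {1..CARD('m)}" by (auto simp: pos_idx_def)
  then have r_le: "r \<le> CARD('m)" "r' \<le> CARD('m)" unfolding P P' by auto
  have pos: "0 < e i" if "i \<in> {1..CARD('m)}" for i
    using adm that by (simp add: admissible_eps_def)
  have anti: "antimono_on {1..r} e" "antimono_on {r+1..CARD('m)} e"
    using adm unfolding admissible_eps_def P Z by blast+
  have anti_pos: "e j \<le> e i" if "1 \<le> i" "i \<le> j" "j \<le> r" for i j
    using that by (intro monotone_onD[OF anti(1)]) auto
  have anti_zero: "e j \<le> e i" if "r + 1 \<le> i" "i \<le> j" "j \<le> CARD('m)" for i j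
    using that by (intro monotone_onD[OF anti(2)]) auto
  have t_pos: "0 < t" if "r' \<noteq> 0" "e' r' = \<mu> * e r' \<or> 0 < e' r'"
  proof -
    have "0 \<le> sing_val A' r'" using that r_le by (intro sing_val_nonneg[OF mn]) auto
    moreover have "0 < e' r'" using that \<mu> pos[of r'] r_le by auto
    ultimately show ?thesis by (simp add: t_def)
  qed
  \<comment> \<open>Supports are initial segments of \<open>{1..CARD('m)}\<close>, so that each clause of the update
    concerns an interval of indices. The extended reals disappear, except in the capping rule.\<close>
  have upd1: "(\<forall>i\<in>{1..r'}. e' i = \<mu> * e i) \<and> (\<forall>i\<in>{r'+1..r}. capped i) \<and>
      (\<forall>i\<in>{r+1..CARD('m)}. e' i = min (e i) (e' r))" if "r' < r"
  proof -
    have "{1..r'} \<subset> {1..r}" "{1..r} - {1..r'} = {r'+1..r}" "r \<noteq> 0" using that by auto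
    then show ?thesis
      using upd[unfolded eps_update_def Let_def P P' Z, folded r_def r'_def]
      by (simp add: capped_def t_def \<tau>1_def ereal_min[symmetric] del: ereal_min)
  qed
  have upd2: "(\<forall>i\<in>{1..r}. e' i = \<mu> * e i) \<and>
      (\<forall>i\<in>{r+1..r'}. e' i = \<mu> * (if r = 0 then e i else min (e i) (e r))) \<and>
      (\<forall>i\<in>{r'+1..CARD('m)}. capped i)" if "r < r'"
  proof -
    have "{1..r} \<subset> {1..r'}" "{1..r'} - {1..r} = {r+1..r'}" using that by auto
    then show ?thesis
      using upd[unfolded eps_update_def Let_def P P' Z', folded r_def r'_def]
      by (auto simp: capped_def t_def \<tau>1_def ereal_min[symmetric] simp del: ereal_min split: if_splits)
  qed
  have upd3: "(\<forall>i\<in>{1..r'}. e' i = \<mu> * e i) \<and> (\<forall>i\<in>{r'+1..CARD('m)}. capped i)" if "r = r'"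
    using upd[unfolded eps_update_def Let_def P P' Z', folded r_def r'_def] that
    by (simp add: capped_def t_def \<tau>1_def)
  show ?thesis
  proof (cases r' r rule: linorder_cases)
    case less
    note u = upd1[OF less]
    obtain c where c: "0 < c" "r' \<noteq> 0 \<Longrightarrow> c \<le> t" and cap: "\<And>i. i \<in> {r'+1..r} \<Longrightarrow> e' i = min (e i) c"
    proof (rule capped_eq_min[OF \<tau>1_def, of \<mu> r e e'])
      show "0 < t" if "r' \<noteq> 0" using that u by (intro t_pos) auto
    qed (use \<mu> pos anti_pos less r_le u in \<open>auto simp: capped_def\<close>)
    have e'_r: "0 < e' r" using cap[of r] c pos[of r] less r_le by auto
    show ?thesis
    proof (rule admissible_epsI[OF mn r'_def])
      fix i assume i: "i \<in> {1..CARD('m)}"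
      then consider "i \<in> {1..r'}" | "i \<in> {r'+1..r}" | "i \<in> {r+1..CARD('m)}" by fastforce
      then show "0 < e' i" using u cap c pos[OF i] e'_r \<mu> by cases auto
    next
      fix i j assume ij: "1 \<le> i" "i \<le> j" "j \<le> r'"
      then show "e' j \<le> e' i" using u \<mu> less anti_pos[of i j] by auto
    next
      fix i j assume ij: "r' + 1 \<le> i" "i \<le> j" "j \<le> CARD('m)"
      consider "j \<le> r" | "i \<le> r" "r < j" | "r < i" by linarith
      then show "e' j \<le> e' i"
      proof cases
        case 1
        then show ?thesis using ij cap anti_pos[of i j] by auto
      next
        case 2
        then have "e' j \<le> e' r" using ij u by auto
        also have "\<dots> \<le> e' i" using 2 ij cap anti_pos[of i r] by auto
        finally show ?thesis .
      next
        case 3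
        then show ?thesis using ij u anti_zero[of i j] by auto
      qed
    next
      assume "r' \<noteq> 0"
      then show "e' (r' + 1) \<le> sing_val A' r' + e' r'"
        using cap[of "r' + 1"] c less by (auto simp: t_def)
    qed
  next
    case equal
    note u = upd3[OF equal[symmetric]]
    obtain c where c: "0 < c" "r' \<noteq> 0 \<Longrightarrow> c \<le> t"
      and cap: "\<And>i. i \<in> {r'+1..CARD('m)} \<Longrightarrow> e' i = min (e i) c"
    proof (rule capped_eq_min[OF \<tau>1_def, of \<mu> "CARD('m)" e e'])
      show "0 < t" if "r' \<noteq> 0" using that u by (intro t_pos) auto
    qed (use \<mu> pos anti_zero equal u in \<open>auto simp: capped_def\<close>)
    show ?thesis
    proof (rule admissible_epsI[OF mn r'_def])
      fix i assume i: "i \<in> {1..CARD('m)}"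
      then consider "i \<in> {1..r'}" | "i \<in> {r'+1..CARD('m)}" by fastforce
      then show "0 < e' i" using u cap c pos[OF i] \<mu> by cases auto
    next
      fix i j assume "1 \<le> i" "i \<le> j" "j \<le> r'"
      then show "e' j \<le> e' i" using u \<mu> equal anti_pos[of i j] by auto
    next
      fix i j assume "r' + 1 \<le> i" "i \<le> j" "j \<le> CARD('m)"
      then show "e' j \<le> e' i" using cap equal anti_zero[of i j] by auto
    next
      assume "r' \<noteq> 0" "r' < CARD('m)"
      then show "e' (r' + 1) \<le> sing_val A' r' + e' r'"
        using cap[of "r' + 1"] c by (auto simp: t_def)
    qed
  next
    case greater
    note u = upd2[OF greater]
    \<comment> \<open>The last positive index is new here, so that positivity of \<open>e'\<close> at it comes from the clause
      for entering indices; that of the other cases comes from scaling by \<open>\<mu>\<close>.\<close>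
    have new: "0 < e' i" if "i \<in> {r+1..r'}" for i
      using u that \<mu> pos[of i] pos[of r] r_le by auto
    obtain c where c: "0 < c" "r' \<noteq> 0 \<Longrightarrow> c \<le> t"
      and cap: "\<And>i. i \<in> {r'+1..CARD('m)} \<Longrightarrow> e' i = min (e i) c"
    proof (rule capped_eq_min[OF \<tau>1_def, of \<mu> "CARD('m)" e e'])
      show "0 < t" if "r' \<noteq> 0" using that new greater by (intro t_pos) auto
    qed (use \<mu> pos anti_zero greater u in \<open>auto simp: capped_def\<close>)
    show ?thesis
    proof (rule admissible_epsI[OF mn r'_def])
      fix i assume i: "i \<in> {1..CARD('m)}"
      then consider "i \<in> {1..r}" | "i \<in> {r+1..r'}" | "i \<in> {r'+1..CARD('m)}" by fastforce
      then show "0 < e' i" using u new cap c pos[OF i] \<mu> by cases auto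
    next
      fix i j assume ij: "1 \<le> i" "i \<le> j" "j \<le> r'"
      consider "j \<le> r" | "i \<le> r" "r < j" | "r < i" by linarith
      then show "e' j \<le> e' i"
      proof cases
        case 1
        then show ?thesis using ij u \<mu> anti_pos[of i j] by auto
      next
        case 2
        then have "e' j = \<mu> * min (e j) (e r)" "e' i = \<mu> * e i" using ij u by auto
        moreover have "min (e j) (e r) \<le> e i" using 2 ij anti_pos[of i r] by auto
        ultimately show ?thesis using \<mu> by simp
      next
        case 3
        then have "e j \<le> e i" using ij r_le by (intro anti_zero) auto
        then show ?thesis using 3 ij u \<mu> by auto
      qed
    next
      fix i j assume "r' + 1 \<le> i" "i \<le> j" "j \<le> CARD('m)"
      then show "e' j \<le> e' i" using cap greater anti_zero[of i j] by auto
    next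
      assume "r' \<noteq> 0" "r' < CARD('m)"
      then show "e' (r' + 1) \<le> sing_val A' r' + e' r'"
        using cap[of "r' + 1"] c by (auto simp: t_def)
    qed
  qed
qed

text \<open>
  Larger values of \<open>\<sigma> + \<epsilon>\<close> give smaller weights, since the exponent \<open>p - 1\<close> is negative.
\<close>
lemma admissible_weight_mono:
  fixes A :: "real^'n^'m"
  assumes mn: "CARD('m) \<le> CARD('n)" and adm: "admissible_eps A e" and p: "0 < p" "p < 1"
  shows "mono_on {1..CARD('m)} (weight p A e)"
proof (rule monotone_onI)
  fix i j assume ij: "i \<in> {1..CARD('m)}" "j \<in> {1..CARD('m)}" "i \<le> j"
  have "0 < sing_val A j + e j"
    using sing_val_nonneg[OF mn ij(2), of A] adm ij(2)
    by (auto simp: admissible_eps_def intro!: add_nonneg_pos)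
  moreover have "sing_val A j + e j \<le> sing_val A i + e i"
    using adm ij monotone_onD[of "{1..CARD('m)}" "(\<le>)" "(\<ge>)" "\<lambda>i. sing_val A i + e i" i j]
    by (simp add: admissible_eps_def)
  ultimately show "weight p A e i \<le> weight p A e j"
    using p by (auto simp: weight_def intro!: mult_left_mono powr_mono2')
qed

section \<open>Iterates with stable support\<close>

text \<open>
  Since the amounts subtracted increase while the singular values decrease, thresholding keeps the
  diagonal sorted, and no permutation of the factors is needed.
\<close>
lemma is_svd_soft_threshold:
  fixes G :: "real^'n^'m"
  assumes "is_svd G U s V" and w: "mono_on {1..CARD('m)} w"
  shows "is_svd (U ** diag_mat (\<lambda>i. max 0 (s i - w i)) ** transpose V) U (\<lambda>i. max 0 (s i - w i)) V"
proof -
  have s: "antimono_on {1..CARD('m)} s" using assms(1) by (simp add: is_svd_def)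
  have "antimono_on {1..CARD('m)} (\<lambda>i. max 0 (s i - w i))"
  proof (rule monotone_onI)
    fix i j assume ij: "i \<in> {1..CARD('m)}" "j \<in> {1..CARD('m)}" "i \<le> j"
    show "max 0 (s j - w j) \<le> max 0 (s i - w i)"
      using monotone_onD[OF s ij] monotone_onD[OF w ij] by simp
  qed
  then show ?thesis using assms(1) by (simp add: is_svd_def)
qed

lemma le_if_scaled_weight_le:
  fixes p x C lam \<beta> :: real
  assumes p: "0 < p" "p < 1" and pos: "0 < x" "0 < C" "0 < lam" "0 < \<beta>"
    and le: "lam * (p * x powr (p - 1)) / (2 * \<beta>) \<le> C"
  shows "(lam * p / (2 * \<beta> * C)) powr (1 / (1 - p)) \<le> x"
proof -
  define y where "y = x powr (1 - p)"
  have "x powr (p - 1) = 1 / y"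
    using powr_minus_divide[of x "1 - p"] by (simp add: y_def)
  with le have "lam * (p * (1 / y)) / (2 * \<beta>) \<le> C" by simp
  moreover have "y > 0" using pos by (simp add: y_def)
  ultimately have "lam * p / (2 * \<beta> * C) \<le> x powr (1 - p)"
    using pos unfolding y_def[symmetric] by (simp add: field_simps)
  then have "(lam * p / (2 * \<beta> * C)) powr (1 / (1 - p)) \<le> (x powr (1 - p)) powr (1 / (1 - p))"
    using p pos by (intro powr_mono2) auto
  also have "\<dots> = x" using p pos by (simp add: powr_powr)
  finally show ?thesis .
qed

lemma EIRNRI_admissible:
  fixes X :: "nat \<Rightarrow> real^'n^'m"
  assumes mn: "CARD('m) \<le> CARD('n)" and \<mu>: "0 < \<mu>" "\<mu> < 1"
    and alg: "EIRNRI g lam p \<beta> \<mu> \<alpha>bar \<alpha> \<epsilon> X"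
  shows "admissible_eps (X k) (\<epsilon> k)"
proof (induction k)
  case 0
  show ?case using alg by (intro antimono_eps_imp_admissible[OF mn]) (simp_all add: EIRNRI_def)
next
  case (Suc k)
  show ?case using eps_update_admissible[OF mn \<mu> Suc] alg by (simp add: EIRNRI_def)
qed

text \<open>
  This is where the invariant pays off: the weights are sorted, so that the thresholded diagonal gives
  the singular values of the next iterate index by index.
\<close>
lemma EIRNRI_sing_val_Suc:
  fixes X :: "nat \<Rightarrow> real^'n^'m"
  assumes mn: "CARD('m) \<le> CARD('n)" and \<mu>: "0 < \<mu>" "\<mu> < 1" and p: "0 < p" "p < 1"
    and "0 \<le> lam" "0 \<le> \<beta>"
    and alg: "EIRNRI g lam p \<beta> \<mu> \<alpha>bar \<alpha> \<epsilon> X" and i: "i \<in> {1..CARD('m)}"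
  shows "sing_val (X (Suc k)) i =
    max 0 (sing_val (grad_point g \<beta> \<alpha> X k) i - lam * weight p (X k) (\<epsilon> k) i / (2 * \<beta>))"
proof -
  obtain U s V where svd: "is_svd (grad_point g \<beta> \<alpha> X k) U s V"
    and X: "X (Suc k) = U ** diag_mat (\<lambda>i. max 0 (s i - lam * weight p (X k) (\<epsilon> k) i / (2 * \<beta>)))
      ** transpose V"
    using alg unfolding EIRNRI_def by blast
  have "mono_on {1..CARD('m)} (weight p (X k) (\<epsilon> k))"
    using admissible_weight_mono[OF mn EIRNRI_admissible[OF mn \<mu> alg] p] .
  then have "mono_on {1..CARD('m)} (\<lambda>i. lam * weight p (X k) (\<epsilon> k) i / (2 * \<beta>))"
    using \<open>0 \<le> lam\<close> \<open>0 \<le> \<beta>\<close> unfolding monotone_on_def by (auto intro!: divide_right_mono mult_left_mono)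
  from is_svd_soft_threshold[OF svd this] show ?thesis
    by (simp only: X[symmetric] sing_val_svd(1)[OF _ i] sing_val_svd(1)[OF svd i])
qed

text \<open>
  If a singular value survives the thresholding, then its threshold is below \<open>C\<close>. This bounds the
  weight from above and therefore the quantity \<open>\<sigma> + \<epsilon>\<close>, from which the weight is computed, away
  from \<open>0\<close>.
\<close>
lemma EIRNRI_pos_idx_lower_bound:
  fixes X :: "nat \<Rightarrow> real^'n^'m"
  assumes mn: "CARD('m) \<le> CARD('n)" and \<mu>: "0 < \<mu>" "\<mu> < 1" and p: "0 < p" "p < 1"
    and "0 < lam" "0 < \<beta>" "0 < C"
    and alg: "EIRNRI g lam p \<beta> \<mu> \<alpha>bar \<alpha> \<epsilon> X"
    and i: "i \<in> pos_idx (X (Suc k))" and C: "sing_val (grad_point g \<beta> \<alpha> X k) i \<le> C"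
  shows "(lam * p / (2 * \<beta> * C)) powr (1 / (1 - p)) \<le> sing_val (X k) i + \<epsilon> k i"
proof (rule le_if_scaled_weight_le[OF p])
  have i': "i \<in> {1..CARD('m)}" using i by (simp add: pos_idx_def)
  show "0 < sing_val (X k) i + \<epsilon> k i"
    using sing_val_nonneg[OF mn i'] EIRNRI_admissible[OF mn \<mu> alg, of k] i'
    by (auto simp: admissible_eps_def intro!: add_nonneg_pos)
  have "0 < sing_val (X (Suc k)) i" using i by (simp add: pos_idx_def)
  then have "0 < sing_val (grad_point g \<beta> \<alpha> X k) i - lam * weight p (X k) (\<epsilon> k) i / (2 * \<beta>)"
    using EIRNRI_sing_val_Suc[OF mn \<mu> p _ _ alg i', of k] \<open>0 < lam\<close> \<open>0 < \<beta>\<close> by simp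
  then show "lam * (p * (sing_val (X k) i + \<epsilon> k i) powr (p - 1)) / (2 * \<beta>) \<le> C"
    using C by (simp add: weight_def)
qed (use assms in auto)

text \<open>
  Once the support is stable, only the third case of the update occurs, and it contracts the entries on
  the support by the factor \<open>\<mu>\<close> in every step.
\<close>
lemma EIRNRI_eps_tendsto_0:
  fixes X :: "nat \<Rightarrow> real^'n^'m"
  assumes \<mu>: "0 < \<mu>" "\<mu> < 1" and alg: "EIRNRI g lam p \<beta> \<mu> \<alpha>bar \<alpha> \<epsilon> X"
    and stable: "\<forall>\<^sub>F k in sequentially. pos_idx (X k) = I" and i: "i \<in> I"
  shows "(\<lambda>k. \<epsilon> k i) \<longlonglongrightarrow> 0"
proof -
  obtain N where N: "pos_idx (X k) = I" if "k \<ge> N" for k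
    using stable by (auto simp: eventually_sequentially)
  have step: "\<epsilon> (Suc k) i = \<mu> * \<epsilon> k i" if "k \<ge> N" for k
  proof -
    have "pos_idx (X k) = pos_idx (X (Suc k))" "i \<in> pos_idx (X (Suc k))"
      using N that i by auto
    moreover have "eps_update \<mu> (X k) (X (Suc k)) (\<epsilon> k) (\<epsilon> (Suc k))"
      using alg unfolding EIRNRI_def by blast
    ultimately show ?thesis unfolding eps_update_def Let_def by blast
  qed
  have "\<epsilon> (k + N) i = \<mu> ^ k * \<epsilon> N i" for k
    by (induction k) (simp_all add: step)
  moreover have "(\<lambda>k. \<mu> ^ k * \<epsilon> N i) \<longlonglongrightarrow> 0"
    using \<mu> by (intro tendsto_mult_left_zero LIMSEQ_realpow_zero) auto
  ultimately have "(\<lambda>k. \<epsilon> (k + N) i) \<longlonglongrightarrow> 0" by simp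
  then show ?thesis by (rule LIMSEQ_offset)
qed

theorem theorem3p4:
  fixes f :: "real^'n^'m \<Rightarrow> real"
    and gradf :: "real^'n^'m \<Rightarrow> real^'n^'m"
    and X :: "nat \<Rightarrow> real^'n^'m"
    and \<epsilon> :: "nat \<Rightarrow> nat \<Rightarrow> real"
    and \<alpha> :: "nat \<Rightarrow> real"
    and p lam Lf \<beta> \<mu> \<alpha>bar C1 :: real
    and Istar :: "nat set"
  assumes "CARD('m) \<le> CARD('n)"
    and "0 < p" and "p < 1" and "0 < lam"
    and "C2_with_gradient f gradf"
    and "Lf \<ge> 0"
    and "\<forall>A B. norm (gradf A - gradf B) \<le> Lf * norm (A - B)"
    and "filterlim (objective f lam p) at_top at_infinity"
    and "Lf < \<beta>" and "0 < \<mu>" and "\<mu> < 1"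
    and "if convex_on UNIV f then \<alpha>bar \<in> {0<..<1}
         else \<alpha>bar \<in> {0<..<sqrt (\<beta> / (\<beta> + 3 * Lf))}"
    and "EIRNRI gradf lam p \<beta> \<mu> \<alpha>bar \<alpha> \<epsilon> X"
    and "0 < C1"
    and "\<forall>k. (MAX i\<in>{1..CARD('m)}. sing_val (grad_point gradf \<beta> \<alpha> X k) i) \<le> C1"
    and "\<forall>\<^sub>F k in sequentially. pos_idx (X k) = Istar"
  shows "(\<forall>\<^sub>F k in sequentially. rank (X k) = card Istar) \<and>
    (\<forall>Xstar. seq_limit_point X Xstar \<longrightarrow>
       rank Xstar = card (pos_idx Xstar) \<and>
       card (pos_idx Xstar) = card Istar \<and>
       (\<forall>i\<in>pos_idx Xstar.
          sing_val Xstar i \<ge> (lam * p / (2 * \<beta> * C1)) powr (1 / (1 - p)) \<and>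
          (lam * p / (2 * \<beta> * C1)) powr (1 / (1 - p)) > 0))"
proof -
  note mn = assms(1) and p = assms(2,3) and lam = assms(4) and \<mu> = assms(10,11)
    and alg = assms(13) and C1 = assms(14) and stable = assms(16)
  have \<beta>: "0 < \<beta>" using assms by simp
  define b where "b = (lam * p / (2 * \<beta> * C1)) powr (1 / (1 - p))"
  have b_pos: "b > 0" using p lam \<beta> C1 by (simp add: b_def)
  have C: "sing_val (grad_point gradf \<beta> \<alpha> X k) i \<le> C1" if "i \<in> {1..CARD('m)}" for i k
    using assms(15) that Max_ge[of "sing_val (grad_point gradf \<beta> \<alpha> X k) ` {1..CARD('m)}"]
    by (meson finite_atLeastAtMost finite_imageI imageI order_trans)
  obtain N where N: "pos_idx (X k) = Istar" if "k \<ge> N" for k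
    using stable by (auto simp: eventually_sequentially)
  have Istar: "Istar \<subseteq> {1..CARD('m)}" using N[of N] by (auto simp: pos_idx_def)
  \<comment> \<open>On \<open>Istar\<close> the lower bound passes to the limit because the perturbations tend to \<open>0\<close> there;
    off \<open>Istar\<close> the singular values eventually vanish. So the support cannot change in the limit.\<close>
  have limit: "pos_idx Xs = Istar \<and> (\<forall>i\<in>Istar. b \<le> sing_val Xs i)" if Xs: "seq_limit_point X Xs" for Xs
  proof -
    obtain q where q: "strict_mono q" "(X \<circ> q) \<longlonglongrightarrow> Xs"
      using Xs by (auto simp: seq_limit_point_def)
    obtain r where r: "strict_mono r"
      and r_lim: "\<And>i. i \<in> {1..CARD('m)} \<Longrightarrow> (\<lambda>k. sing_val ((X \<circ> q) (r k)) i) \<longlonglongrightarrow> sing_val Xs i"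
      using sing_val_subseq_tendsto[OF mn q(2)] by blast
    define h where "h = q \<circ> r"
    have h: "strict_mono h" using q r by (simp add: h_def strict_mono_o)
    have lim: "(\<lambda>k. sing_val (X (h k)) i) \<longlonglongrightarrow> sing_val Xs i" if "i \<in> {1..CARD('m)}" for i
      using r_lim[OF that] by (simp add: h_def)
    have h_ge: "h k \<ge> N" if "k \<ge> N" for k
      using seq_suble[OF h, of k] that by simp
    have lower: "b \<le> sing_val Xs i" if i: "i \<in> Istar" for i
    proof (rule LIMSEQ_le_const)
      have "(\<lambda>k. \<epsilon> (h k) i) \<longlonglongrightarrow> 0"
        using LIMSEQ_subseq_LIMSEQ[OF EIRNRI_eps_tendsto_0[OF \<mu> alg stable i] h] by (simp add: o_def)
      from tendsto_add[OF lim this]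
      show "(\<lambda>k. sing_val (X (h k)) i + \<epsilon> (h k) i) \<longlonglongrightarrow> sing_val Xs i"
        using i Istar by auto
      \<comment> \<open>The bound for iterate \<open>h k\<close> comes from the support of its successor, which is \<open>Istar\<close> as well.\<close>
      have "b \<le> sing_val (X (h k)) i + \<epsilon> (h k) i" if "k \<ge> N" for k
        unfolding b_def using i Istar N[of "Suc (h k)"] h_ge[OF that]
        by (intro EIRNRI_pos_idx_lower_bound[OF mn \<mu> p lam \<beta> C1 alg] C) auto
      then show "\<exists>N. \<forall>k\<ge>N. b \<le> sing_val (X (h k)) i + \<epsilon> (h k) i" by blast
    qed
    have zero: "sing_val Xs i = 0" if i: "i \<in> {1..CARD('m)}" "i \<notin> Istar" for i
    proof (rule LIMSEQ_unique[OF lim[OF i(1)]])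
      have "sing_val (X (h k)) i = 0" if "k \<ge> N" for k
      proof -
        have "i \<in> zero_idx (X (h k))"
          unfolding zero_idx_eq[OF mn] N[OF h_ge[OF that]] using i by blast
        then show ?thesis by (simp add: zero_idx_def)
      qed
      then show "(\<lambda>k. sing_val (X (h k)) i) \<longlonglongrightarrow> 0"
        by (intro tendsto_eventually eventually_sequentiallyI[of N])
    qed
    have "i \<in> pos_idx Xs \<longleftrightarrow> i \<in> Istar" for i
      using lower[of i] zero[of i] b_pos Istar by (cases "i \<in> Istar") (auto simp: pos_idx_def)
    then show ?thesis using lower by blast
  qed
  have "\<forall>\<^sub>F k in sequentially. rank (X k) = card Istar"
    using stable by eventually_elim (simp add: rank_eq_card_pos_idx[OF mn])
  moreover have "rank Xs = card (pos_idx Xs)" for Xs :: "real^'n^'m"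
    by (rule rank_eq_card_pos_idx[OF mn])
  ultimately show ?thesis
    using limit b_pos unfolding b_def[symmetric] by simp
qed

end
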